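(* Let $\Sigma=\{\veebar,\wedge,\vee,\mathbin{\dot\vee}\}$, let $n,m\geq 1$, and let $\Phi_n=\{p_1,\dots,p_n\}$. \begin{enumerate} \item If $m\leq 2^n$ and $k<m$, then every $\mathrm{PL}(\Sigma)$-formula $\varphi$ that defines the property $|T|\equiv k \pmod m$ of $\Phi_n$-teams (i.e. for every $\Phi_n$-team $T$: $T\models\varphi$ iff $|T|\equiv k\pmod m$) has length at least $2^n-[2^n-k]_m$, where $[x]_m$ denotes the remainder of $x$ modulo $m$. In particular, a formula defining even cardinality of $\Phi_n$-teams has length at least $2^n$. \item For $k\leq 2^n$, every $\mathrm{PL}(\Sigma)$-formula that defines the property $|T|=k$ of $\Phi_n$-teams $T$ has length at least $k$. \item Every $\mathrm{PL}(\Sigma)$-formula that defines (is equivalent to) the inclusion atom $p_1\cdots p_n\subseteq q_1\cdots q_n$ has length at least $2^n$. \item Every $\mathrm{PL}(\Sigma)$-formula that defines (is equivalent to) the independence atom $p_1\cdots p_n\perp q_1\cdots q_m$ has length at least $2^{n+m}$. \item Every $\mathrm{PL}(\Sigma)$-formula that defines (is equivalent to) the anonymity atom $p_1\cdots p_n\,\Upsilon\, q$ has length at least $2^{n+1}$. \end{enumerate} Here $p_1,\dots,p_n,q,q_1,\dots,q_m$ are pairwise distinct propositional variables.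
   Context: A domain $\Phi$ is a finite set of propositional variables; a $\Phi$-assignment is a map $s:\Phi\to\{0,1\}$; a $\Phi$-team is a (possibly empty) set of $\Phi$-assignments. A split of a team $T$ is a pair $(T_1,T_2)$ with $T_1,T_2\subseteq T$ and $T_1\cup T_2=T$; it is strict if $T_1\cap T_2=\emptyset$. For a set $\Sigma$ of connectives, $\mathrm{PL}(\Sigma)$ is the set of formulas built from the literals $\top,\bot,{\sim}\top,{\sim}\bot,p,\neg p,{\sim}p,{\sim}\neg p$ ($p$ a propositional variable) by the connectives in $\Sigma$. Semantics on a team $T$: $T\models\top$ always; $T\models\bot$ iff $T=\emptyset$; $T\models p$ iff $s(p)=1$ for all $s\in T$; $T\models\neg p$ iff $s(p)=0$ for all $s\in T$; $T\models{\sim}\psi$ iff $T\not\models\psi$; $T\models\psi\wedge\theta$ iff $T\models\psi$ and $T\models\theta$; $T\models\psi\veebar\theta$ (Boolean disjunction) iff $T\models\psi$ or $T\models\theta$; $T\models\psi\vee\theta$ iff there is a split $(S,U)$ of $T$ with $S\models\psi$ and $U\models\theta$; $T\models\psi\mathbin{\dot\vee}\theta$ iff there is a strict split $(S,U)$ of $T$ with $S\models\psi$ and $U\models\theta$. Two formulas are equivalent if they are satisfied by the same teams for every domain containing all their variables. The length of a formula is its length as a string, each propositional variable counting as one symbol. For an assignment $s$ and a tuple of variables $\vec p$, $s(\vec p)$ is the tuple of values. Atoms: $T\models \vec p\subseteq\vec q$ iff for every $s\in T$ there is $s'\in T$ with $s(\vec p)=s'(\vec q)$ ($\vec p,\vec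 q$ of equal length); $T\models\vec p\perp\vec q$ iff for all $s,s'\in T$ there is $s''\in T$ with $s''(\vec p)=s(\vec p)$ and $s''(\vec q)=s'(\vec q)$; $T\models\vec p\,\Upsilon\,\vec q$ iff for every $s\in T$ there is $s'\in T$ with $s'(\vec p)=s(\vec p)$ and $s'(\vec q)\neq s(\vec q)$.
   Formalization: Item 1 (the bound for |T| ≡ k mod m) is proved for m ≥ 2 only; for m = 1 the claim is false, since ⊤, of length 1, defines |T| ≡ 0 (mod 1) while the stated bound is 2^n ≥ 2. *)

theory Defs
  imports "HOL-Number_Theory.Cong" "HOL-Library.FuncSet"
begin

datatype connective = BDisj | Conj | Split | StrictSplit

text \<open>\<open>Neg p\<close> is the literal written with the classical negation sign in front of \<open>p\<close>,
  and \<open>TNeg\<close> is the contradictory (team) negation. \<open>Incl\<close>, \<open>Indep\<close> and \<open>Anon\<close> are the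
  inclusion, independence and anonymity atoms on tuples of variables.\<close>

datatype (vars: 'v) formula =
    Top
  | Bot
  | Var 'v
  | Neg 'v
  | TNeg "'v formula"
  | Bin connective "'v formula" "'v formula"
  | Incl "'v list" "'v list"
  | Indep "'v list" "'v list"
  | Anon "'v list" "'v list"

inductive_set PL :: "connective set \<Rightarrow> 'v formula set" for \<Sigma> :: "connective set" where
  "Top \<in> PL \<Sigma>"
| "Bot \<in> PL \<Sigma>"
| "TNeg Top \<in> PL \<Sigma>"
| "TNeg Bot \<in> PL \<Sigma>"
| "Var p \<in> PL \<Sigma>"
| "Neg p \<in> PL \<Sigma>"
| "TNeg (Var p) \<in> PL \<Sigma>"
| "TNeg (Neg p) \<in> PL \<Sigma>"
| "c \<in> \<Sigma> \<Longrightarrow> \<phi> \<in> PL \<Sigma> \<Longrightarrow> \<psi> \<in> PL \<Sigma> \<Longrightarrow> Bin c \<phi> \<psi> \<in> PL \<Sigma>"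

text \<open>Brackets are not counted. As the length only enters through lower bounds, the bounds for any
  bracketing convention follow.\<close>

primrec formula_length :: "'v formula \<Rightarrow> nat" where
  "formula_length Top = 1"
| "formula_length Bot = 1"
| "formula_length (Var p) = 1"
| "formula_length (Neg p) = 2"
| "formula_length (TNeg \<phi>) = 1 + formula_length \<phi>"
| "formula_length (Bin c \<phi> \<psi>) = formula_length \<phi> + 1 + formula_length \<psi>"
| "formula_length (Incl ps qs) = length ps + 1 + length qs"
| "formula_length (Indep ps qs) = length ps + 1 + length qs"
| "formula_length (Anon ps qs) = length ps + 1 + length qs"

type_synonym 'v assignment = "'v \<Rightarrow> bool"

definition assignments :: "'v set \<Rightarrow> 'v assignment set" where
  "assignments \<Phi> = \<Phi> \<rightarrow>\<^sub>E UNIV"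

definition teams :: "'v set \<Rightarrow> 'v assignment set set" where
  "teams \<Phi> = Pow (assignments \<Phi>)"

definition is_split :: "'a set \<Rightarrow> 'a set \<Rightarrow> 'a set \<Rightarrow> bool" where
  "is_split T T\<^sub>1 T\<^sub>2 \<longleftrightarrow> T\<^sub>1 \<subseteq> T \<and> T\<^sub>2 \<subseteq> T \<and> T\<^sub>1 \<union> T\<^sub>2 = T"

definition is_strict_split :: "'a set \<Rightarrow> 'a set \<Rightarrow> 'a set \<Rightarrow> bool" where
  "is_strict_split T T\<^sub>1 T\<^sub>2 \<longleftrightarrow> is_split T T\<^sub>1 T\<^sub>2 \<and> T\<^sub>1 \<inter> T\<^sub>2 = {}"

primrec connective_sem ::
  "connective \<Rightarrow> ('a set \<Rightarrow> bool) \<Rightarrow> ('a set \<Rightarrow> bool) \<Rightarrow> 'a set \<Rightarrow> bool" where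
  "connective_sem BDisj P Q T \<longleftrightarrow> P T \<or> Q T"
| "connective_sem Conj P Q T \<longleftrightarrow> P T \<and> Q T"
| "connective_sem Split P Q T \<longleftrightarrow> (\<exists>S U. is_split T S U \<and> P S \<and> Q U)"
| "connective_sem StrictSplit P Q T \<longleftrightarrow> (\<exists>S U. is_strict_split T S U \<and> P S \<and> Q U)"

primrec sat :: "'v formula \<Rightarrow> 'v assignment set \<Rightarrow> bool" where
  "sat Top T \<longleftrightarrow> True"
| "sat Bot T \<longleftrightarrow> T = {}"
| "sat (Var p) T \<longleftrightarrow> (\<forall>s\<in>T. s p)"
| "sat (Neg p) T \<longleftrightarrow> (\<forall>s\<in>T. \<not> s p)"
| "sat (TNeg \<phi>) T \<longleftrightarrow> \<not> sat \<phi> T"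
| "sat (Bin c \<phi> \<psi>) T \<longleftrightarrow> connective_sem c (sat \<phi>) (sat \<psi>) T"
| "sat (Incl ps qs) T \<longleftrightarrow> (\<forall>s\<in>T. \<exists>s'\<in>T. map s ps = map s' qs)"
| "sat (Indep ps qs) T \<longleftrightarrow>
     (\<forall>s\<in>T. \<forall>s'\<in>T. \<exists>s''\<in>T. map s'' ps = map s ps \<and> map s'' qs = map s' qs)"
| "sat (Anon ps qs) T \<longleftrightarrow> (\<forall>s\<in>T. \<exists>s'\<in>T. map s' ps = map s ps \<and> map s' qs \<noteq> map s qs)"

definition equivalent :: "'v formula \<Rightarrow> 'v formula \<Rightarrow> bool" where
  "equivalent \<phi> \<psi> \<longleftrightarrow>
     (\<forall>\<Phi>. finite \<Phi> \<and> vars \<phi> \<union> vars \<psi> \<subseteq> \<Phi> \<longrightarrow> (\<forall>T\<in>teams \<Phi>. sat \<phi> T \<longleftrightarrow> sat \<psi> T))"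

text \<open>Evaluating a formula on \<open>\<Phi>\<close>-teams only makes sense if its variables lie in \<open>\<Phi>\<close>.\<close>

definition defines_property ::
  "'v set \<Rightarrow> 'v formula \<Rightarrow> ('v assignment set \<Rightarrow> bool) \<Rightarrow> bool" where
  "defines_property \<Phi> \<phi> P \<longleftrightarrow> vars \<phi> \<subseteq> \<Phi> \<and> (\<forall>T\<in>teams \<Phi>. sat \<phi> T \<longleftrightarrow> P T)"

text \<open>Modulus 1 has to be excluded from the lower bound for cardinality modulo \<open>m\<close>: that property
  holds of every team, so a formula of length 1 defines it, whereas the bound would be \<open>2 ^ n\<close>.\<close>

lemma modulus_one_counterexample:
  "Top \<in> PL \<Sigma>" "formula_length Top = 1"
  "defines_property \<Phi> Top (\<lambda>T. [card T = 0] (mod 1))"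
  "2 ^ n - (2 ^ n - 0) mod 1 = (2 :: nat) ^ n"
  by (simp_all add: PL.intros defines_property_def cong_def)

end

theory Submission
  imports Defs
begin

section \<open>Witness sets and critical teams\<close>

text \<open>If \<open>T\<close> satisfies a formula of \<open>PL \<Sigma>\<close>, then so does every team between some \<open>W \<subseteq> T\<close> and \<open>T\<close>,
  where \<open>W\<close> collects one witness for each literal that is negated by \<open>TNeg\<close>: all other literals are
  downward closed, and each of the four connectives preserves this property, since a split of \<open>T\<close>
  restricts to any subteam. Hence a formula with a satisfying team \<open>T\<close> that cannot
  spare any of its assignments has length at least \<open>card T\<close>, and each bound follows by exhibiting such
  a critical team of the right size.\<close>

lemma PL_witness_set:
  assumes "\<phi> \<in> PL \<Sigma>" and "sat \<phi> T"
  shows "\<exists>W\<subseteq>T. finite W \<and> card W \<le> formula_length \<phi> \<and> (\<forall>X. W \<subseteq> X \<and> X \<subseteq> T \<longrightarrow> sat \<phi> X)"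
  using assms
proof (induction arbitrary: T rule: PL.induct)
  \<comment> \<open>\<open>TNeg Bot\<close>, \<open>TNeg (Var p)\<close> and
    \<open>TNeg (Neg p)\<close> are upward closed: a single assignment that makes one of them true
    keeps it true in every larger team.\<close>
  case 4
  then obtain s where "s \<in> T" by auto
  then show ?case by (intro exI[of _ "{s}"]) auto
next
  case (7 p)
  then obtain s where "s \<in> T" "\<not> s p" by auto
  then show ?case by (intro exI[of _ "{s}"]) auto
next
  case (8 p)
  then obtain s where "s \<in> T" "s p" by auto
  then show ?case by (intro exI[of _ "{s}"]) auto
next
  case (9 c \<phi> \<psi>)
  let ?wit = "\<lambda>\<chi> S W. W \<subseteq> S \<and> finite W \<and> card W \<le> formula_length \<chi> \<and>
    (\<forall>X. W \<subseteq> X \<and> X \<subseteq> S \<longrightarrow> sat \<chi> X)"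
  \<comment> \<open>Witness sizes add up like the lengths of the two subformulas. \<open>S\<close>
    and \<open>U\<close> are the parts of a split, or both equal to \<open>T\<close> for
    \<open>Conj\<close>.\<close>
  have union: "W1 \<union> W2 \<subseteq> T \<and> finite (W1 \<union> W2) \<and> card (W1 \<union> W2) \<le> formula_length (Bin c \<phi> \<psi>)"
    if "?wit \<phi> S W1" "?wit \<psi> U W2" "S \<subseteq> T" "U \<subseteq> T" for S U W1 W2
    using that card_Un_le[of W1 W2] by auto
  show ?case
  proof (cases c)
    case BDisj
    then consider "sat \<phi> T" | "sat \<psi> T" using "9.prems" by auto
    then show ?thesis
    proof cases
      case 1
      from "9.IH"(1)[OF this] obtain W where "?wit \<phi> T W" by blast
      then show ?thesis using BDisj by (intro exI[of _ W]) auto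
    next
      case 2
      from "9.IH"(2)[OF this] obtain W where "?wit \<psi> T W" by blast
      then show ?thesis using BDisj by (intro exI[of _ W]) auto
    qed
  next
    case Conj
    then have "sat \<phi> T" "sat \<psi> T" using "9.prems" by auto
    from "9.IH"(1)[OF this(1)] "9.IH"(2)[OF this(2)] obtain W1 W2
      where W: "?wit \<phi> T W1" "?wit \<psi> T W2" by blast
    have "sat (Bin c \<phi> \<psi>) X" if "W1 \<union> W2 \<subseteq> X" "X \<subseteq> T" for X
      using W that Conj by simp
    with union[OF W] show ?thesis by (intro exI[of _ "W1 \<union> W2"]) simp
  next
    case Split
    then obtain S U where SU: "is_split T S U" "sat \<phi> S" "sat \<psi> U" using "9.prems" by auto
    from "9.IH"(1)[OF SU(2)] "9.IH"(2)[OF SU(3)] obtain W1 W2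
      where W: "?wit \<phi> S W1" "?wit \<psi> U W2" by blast
    have "sat (Bin c \<phi> \<psi>) X" if "W1 \<union> W2 \<subseteq> X" "X \<subseteq> T" for X
    proof -
      \<comment> \<open>The trace \<open>X \<inter> S\<close> lies between \<open>W1\<close> and
        \<open>S\<close>, and \<open>X \<inter> U\<close> between \<open>W2\<close> and
        \<open>U\<close>, so both remain in the range covered by the induction hypotheses.\<close>
      have "is_split X (X \<inter> S) (X \<inter> U)" using SU(1) that(2) by (auto simp: is_split_def)
      moreover have "sat \<phi> (X \<inter> S)" "sat \<psi> (X \<inter> U)" using W that(1) by auto
      ultimately show ?thesis using Split by auto
    qed
    moreover have "S \<subseteq> T" "U \<subseteq> T" using SU(1) by (auto simp: is_split_def)
    ultimately show ?thesis using union[OF W] by (intro exI[of _ "W1 \<union> W2"]) simp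
  next
    case StrictSplit
    then obtain S U where SU: "is_strict_split T S U" "sat \<phi> S" "sat \<psi> U" using "9.prems" by auto
    from "9.IH"(1)[OF SU(2)] "9.IH"(2)[OF SU(3)] obtain W1 W2
      where W: "?wit \<phi> S W1" "?wit \<psi> U W2" by blast
    have "sat (Bin c \<phi> \<psi>) X" if "W1 \<union> W2 \<subseteq> X" "X \<subseteq> T" for X
    proof -
      have "is_strict_split X (X \<inter> S) (X \<inter> U)"
        using SU(1) that(2) by (auto simp: is_split_def is_strict_split_def)
      moreover have "sat \<phi> (X \<inter> S)" "sat \<psi> (X \<inter> U)" using W that(1) by auto
      ultimately show ?thesis using StrictSplit by auto
    qed
    moreover have "S \<subseteq> T" "U \<subseteq> T" using SU(1) by (auto simp: is_split_def is_strict_split_def)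
    ultimately show ?thesis using union[OF W] by (intro exI[of _ "W1 \<union> W2"]) simp
  qed
next
  case 5
  then show ?case by (intro exI[of _ "{}"]) auto
next
  case 6
  then show ?case by (intro exI[of _ "{}"]) auto
qed (simp_all add: exI[of _ "{}"])

text \<open>A witness set \<open>W\<close> must be all of \<open>T\<close>: if it missed some
  \<open>s\<close>, then \<open>T - {s}\<close> would lie between \<open>W\<close> and
  \<open>T\<close> and still satisfy the formula.\<close>

lemma card_critical_team_le_length:
  assumes "\<phi> \<in> PL \<Sigma>" and "sat \<phi> T" and "\<And>s. s \<in> T \<Longrightarrow> \<not> sat \<phi> (T - {s})"
  shows "card T \<le> formula_length \<phi>"
proof -
  obtain W where W: "W \<subseteq> T" "card W \<le> formula_length \<phi>"
    "\<And>X. W \<subseteq> X \<Longrightarrow> X \<subseteq> T \<Longrightarrow> sat \<phi> X"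
    using PL_witness_set[OF assms(1,2)] by blast
  have "T \<subseteq> W"
  proof
    fix s assume "s \<in> T"
    then have "\<not> W \<subseteq> T - {s}" using assms(3) W(3)[of "T - {s}"] by blast
    then show "s \<in> W" using W(1) by blast
  qed
  with W show ?thesis by (simp add: subset_antisym)
qed

lemma finite_vars: "finite (vars \<phi>)"
  by (induction \<phi>) auto

lemma equivalent_satD:
  assumes "equivalent \<phi> \<psi>" and "T \<subseteq> assignments (vars \<phi> \<union> vars \<psi>)"
  shows "sat \<phi> T \<longleftrightarrow> sat \<psi> T"
proof -
  have "finite (vars \<phi> \<union> vars \<psi>)" by (simp add: finite_vars)
  then show ?thesis using assms unfolding equivalent_def teams_def by blast
qed

text \<open>Criticality is checked for \<open>\<psi>\<close> and carried over to
  \<open>\<phi>\<close>. The team lives over the joint domain, since \<open>\<phi>\<close> may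
  mention variables that do not occur in \<open>\<psi>\<close>.\<close>

lemma card_critical_team_le_length_equivalent:
  assumes "\<phi> \<in> PL \<Sigma>" and "equivalent \<phi> \<psi>" and "T \<subseteq> assignments (vars \<phi> \<union> vars \<psi>)"
    and "sat \<psi> T" and "\<And>s. s \<in> T \<Longrightarrow> \<not> sat \<psi> (T - {s})"
  shows "card T \<le> formula_length \<phi>"
proof (rule card_critical_team_le_length[OF assms(1)])
  show "sat \<phi> T" using equivalent_satD[OF assms(2,3)] assms(4) by simp
  show "\<not> sat \<phi> (T - {s})" if "s \<in> T" for s
    using assms(5)[OF that] equivalent_satD[OF assms(2), of "T - {s}"] assms(3) by auto
qed

section \<open>Cardinality properties\<close>

lemma card_assignments: "finite \<Phi> \<Longrightarrow> card (assignments \<Phi>) = 2 ^ card \<Phi>"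
  by (simp add: assignments_def card_PiE)

text \<open>Any team of size \<open>t\<close> is critical, since deleting an assignment leaves size
  \<open>t - 1\<close>, where \<open>P\<close> fails. The guard \<open>t > 0\<close> is there
  because truncated subtraction gives \<open>t - 1 = t\<close> at zero; the empty team is vacuously
  critical.\<close>

lemma le_length_if_defines_cardinality:
  assumes "finite \<Phi>" and "\<phi> \<in> PL \<Sigma>" and "defines_property \<Phi> \<phi> (\<lambda>T. P (card T))"
    and "t \<le> 2 ^ card \<Phi>" and "P t" and "t > 0 \<Longrightarrow> \<not> P (t - 1)"
  shows "t \<le> formula_length \<phi>"
proof -
  obtain T where T: "T \<subseteq> assignments \<Phi>" "card T = t" "finite T"
    using obtain_subset_with_card_n[of t "assignments \<Phi>"] assms(1,4) by (auto simp: card_assignments)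
  have sat: "sat \<phi> X \<longleftrightarrow> P (card X)" if "X \<subseteq> T" for X
    using assms(3) T(1) that by (auto simp: defines_property_def teams_def)
  have "card T \<le> formula_length \<phi>"
  proof (rule card_critical_team_le_length[OF assms(2)])
    show "sat \<phi> T" using sat[of T] T(2) assms(5) by simp
    show "\<not> sat \<phi> (T - {s})" if "s \<in> T" for s
    proof -
      have "t > 0" using that T(2,3) card_gt_0_iff by blast
      then show ?thesis using sat[of "T - {s}"] that T(2,3) assms(6) by auto
    qed
  qed
  with T(2) show ?thesis by simp
qed

text \<open>The bound is the largest number up to \<open>2 ^ card \<Phi>\<close> that is congruent
  to \<open>k\<close>. Its predecessor is not congruent to \<open>k\<close>, because the modulus is
  at least 2.\<close>

lemma length_ge_card_mod:
  assumes "finite \<Phi>" and "\<phi> \<in> PL \<Sigma>" and "defines_property \<Phi> \<phi> (\<lambda>T. [card T = k] (mod m))"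
    and "2 \<le> m" and "k \<le> 2 ^ card \<Phi>"
  shows "2 ^ card \<Phi> - (2 ^ card \<Phi> - k) mod m \<le> formula_length \<phi>"
proof (rule le_length_if_defines_cardinality[OF assms(1-3)])
  define N :: nat where "N = 2 ^ card \<Phi>"
  let ?t = "N - (N - k) mod m"
  have "?t = k + m * ((N - k) div m)"
    using assms(5) mult_div_mod_eq[of m "N - k"] unfolding N_def[symmetric] by linarith
  then have t: "[?t = k] (mod m)" by (simp add: cong_def)
  then show "[2 ^ card \<Phi> - (2 ^ card \<Phi> - k) mod m = k] (mod m)" by (simp add: N_def)
  have "\<not> [?t - 1 = k] (mod m)" if "?t > 0"
  proof
    assume "[?t - 1 = k] (mod m)"
    \<comment> \<open>Both \<open>?t\<close> and \<open>?t - 1\<close> would be congruent to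
      \<open>k\<close>; cancelling \<open>?t - 1\<close> leaves 1 congruent to 0.\<close>
    with t have "[?t - 1 = ?t - 1 + 1] (mod m)"
      using that by (metis Suc_eq_plus1 Suc_pred' cong_sym cong_trans)
    then have "[1 = 0] (mod m)"
      by (metis add_0_right cong_add_lcancel_nat cong_sym)
    then show False using assms(4) by (simp add: cong_def)
  qed
  then show "\<not> [2 ^ card \<Phi> - (2 ^ card \<Phi> - k) mod m - 1 = k] (mod m)"
    if "0 < 2 ^ card \<Phi> - (2 ^ card \<Phi> - k) mod m"
    using that by (simp add: N_def)
qed simp

text \<open>Here \<open>t\<close> is the size of the full team: \<open>2 ^ card \<Phi>\<close> is
  even because \<open>\<Phi>\<close> is nonempty, and its predecessor is odd.\<close>

lemma length_ge_even_card:
  assumes "finite \<Phi>" and "\<Phi> \<noteq> {}" and "\<phi> \<in> PL \<Sigma>"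
    and "defines_property \<Phi> \<phi> (\<lambda>T. even (card T))"
  shows "2 ^ card \<Phi> \<le> formula_length \<phi>"
  using assms by (intro le_length_if_defines_cardinality[OF assms(1,3,4)]) (auto simp: card_gt_0_iff)

section \<open>Teams coded as families of sets of variables\<close>

text \<open>Coding an assignment by its true variables turns conditions on value tuples into set
  algebra. The restriction is needed to land in the extensional function space
  \<open>assignments \<Phi>\<close>.\<close>

definition set_assignment :: "'v set \<Rightarrow> 'v set \<Rightarrow> 'v assignment" where
  "set_assignment \<Phi> A = restrict (\<lambda>v. v \<in> A) \<Phi>"

lemma set_assignment_in_assignments: "set_assignment \<Phi> A \<in> assignments \<Phi>"
  by (simp add: set_assignment_def assignments_def)

lemma map_set_assignment:
  "set xs \<subseteq> \<Phi> \<Longrightarrow> map (set_assignment \<Phi> A) xs = map (\<lambda>v. v \<in> A) xs"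
  by (auto simp: set_assignment_def)

lemma map_set_assignment_eq_iff:
  assumes "set xs \<subseteq> \<Phi>"
  shows "map (set_assignment \<Phi> A) xs = map (set_assignment \<Phi> B) xs \<longleftrightarrow> A \<inter> set xs = B \<inter> set xs"
  using assms by (auto simp: map_set_assignment)

lemma inj_on_set_assignment: "inj_on (set_assignment \<Phi>) (Pow \<Phi>)"
proof (rule inj_onI)
  fix A B assume "A \<in> Pow \<Phi>" "B \<in> Pow \<Phi>" "set_assignment \<Phi> A = set_assignment \<Phi> B"
  then show "A = B" unfolding set_assignment_def by (metis Pow_iff restrict_apply' subset_antisym subset_iff)
qed

lemma set_assignment_image_Diff:
  assumes "\<A> \<subseteq> Pow \<Phi>" and "A \<in> \<A>"
  shows "set_assignment \<Phi> ` \<A> - {set_assignment \<Phi> A} = set_assignment \<Phi> ` (\<A> - {A})"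
  using inj_on_image_set_diff[OF inj_on_set_assignment[of \<Phi>], of \<A> "{A}"] assms by auto

text \<open>The coding is injective on \<open>Pow \<Phi>\<close>, so deleting one set deletes
  exactly one assignment and sizes agree. Since the sets contain only variables of
  \<open>\<psi>\<close>, every extra variable of \<open>\<phi>\<close> is false throughout the
  team.\<close>

lemma card_critical_family_le_length:
  assumes "\<phi> \<in> PL \<Sigma>" and "equivalent \<phi> \<psi>" and \<Phi>: "\<Phi> = vars \<phi> \<union> vars \<psi>" and \<A>: "\<A> \<subseteq> Pow (vars \<psi>)"
    and "sat \<psi> (set_assignment \<Phi> ` \<A>)"
    and "\<And>A. A \<in> \<A> \<Longrightarrow> \<not> sat \<psi> (set_assignment \<Phi> ` (\<A> - {A}))"
  shows "card \<A> \<le> formula_length \<phi>"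
proof -
  have sub: "\<A> \<subseteq> Pow \<Phi>" using \<Phi> \<A> by auto
  have "card (set_assignment \<Phi> ` \<A>) \<le> formula_length \<phi>"
  proof (rule card_critical_team_le_length_equivalent[OF assms(1,2) _ assms(5)])
    show "set_assignment \<Phi> ` \<A> \<subseteq> assignments (vars \<phi> \<union> vars \<psi>)"
      using set_assignment_in_assignments \<Phi> by blast
    show "\<not> sat \<psi> (set_assignment \<Phi> ` \<A> - {s})" if "s \<in> set_assignment \<Phi> ` \<A>" for s
      using that assms(6) set_assignment_image_Diff[OF sub] by auto
  qed
  then show ?thesis using card_image[OF inj_on_subset[OF inj_on_set_assignment sub]] by simp
qed

section \<open>Inclusion, independence and anonymity atoms\<close>

text \<open>The critical team assigns to \<open>qs\<close> the bitwise complement of \<open>ps\<close>: every value of \<open>qs\<close> occurs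
  exactly once, and it is needed by a different assignment.\<close>

lemma length_ge_Incl:
  assumes "ps \<noteq> []" and "length qs = length ps" and "distinct (ps @ qs)"
    and "\<phi> \<in> PL \<Sigma>" and "equivalent \<phi> (Incl ps qs)"
  shows "2 ^ length ps \<le> formula_length \<phi>"
proof -
  define \<Phi> where "\<Phi> = vars \<phi> \<union> vars (Incl ps qs)"
  define C where "C A = A \<union> {qs ! i | i. i < length ps \<and> ps ! i \<notin> A}" for A
  define \<A> where "\<A> = C ` Pow (set ps)"
  have sub: "set ps \<subseteq> \<Phi>" "set qs \<subseteq> \<Phi>" by (auto simp: \<Phi>_def)
  have C_ps: "C A \<inter> set ps = A" if "A \<subseteq> set ps" for A
    using that assms(2,3) by (auto simp: C_def)
  have C_qs: "qs ! i \<in> C A \<longleftrightarrow> ps ! i \<notin> A" if "A \<subseteq> set ps" "i < length ps" for A i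
    using that assms(2,3) nth_eq_iff_index_eq[of qs] by (fastforce simp: C_def)
  have eq: "map (set_assignment \<Phi> (C A)) ps = map (set_assignment \<Phi> (C B)) qs \<longleftrightarrow> A = set ps - B"
    if "A \<subseteq> set ps" "B \<subseteq> set ps" for A B
  proof -
    have "map (set_assignment \<Phi> (C A)) ps = map (set_assignment \<Phi> (C B)) qs \<longleftrightarrow>
        (\<forall>i<length ps. ps ! i \<in> C A \<longleftrightarrow> qs ! i \<in> C B)"
      using sub assms(2) by (simp add: map_set_assignment list_eq_iff_nth_eq)
    also have "\<dots> \<longleftrightarrow> (\<forall>i<length ps. ps ! i \<in> A \<longleftrightarrow> ps ! i \<notin> B)"
      using C_qs[OF that(2)] C_ps[OF that(1)] nth_mem[of _ ps] by blast
    also have "\<dots> \<longleftrightarrow> (\<forall>v\<in>set ps. v \<in> A \<longleftrightarrow> v \<notin> B)"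
      by (simp add: all_set_conv_all_nth)
    also have "\<dots> \<longleftrightarrow> A = set ps - B" using that by blast
    finally show ?thesis .
  qed
  have inj: "inj_on C (Pow (set ps))"
    using C_ps by (metis PowD inj_onI)
  have "card \<A> \<le> formula_length \<phi>"
  proof (rule card_critical_family_le_length[OF assms(4,5) \<Phi>_def])
    show "\<A> \<subseteq> Pow (vars (Incl ps qs))" using assms(2) by (auto simp: \<A>_def C_def)
    have "\<exists>B\<in>Pow (set ps). A = set ps - B" if "A \<in> Pow (set ps)" for A
      using that by (intro bexI[of _ "set ps - A"]) auto
    then show "sat (Incl ps qs) (set_assignment \<Phi> ` \<A>)"
      using eq by (fastforce simp: \<A>_def)
    show "\<not> sat (Incl ps qs) (set_assignment \<Phi> ` (\<A> - {A'}))" if A': "A' \<in> \<A>" for A'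
    proof
      obtain A where A: "A \<subseteq> set ps" "A' = C A" using A' by (auto simp: \<A>_def)
      \<comment> \<open>By \<open>eq\<close>, \<open>C A\<close> is the only member whose
        \<open>qs\<close> value equals the \<open>ps\<close> value of \<open>C ?B\<close>. Deleting
        it therefore breaks the atom at \<open>C ?B\<close>.\<close>
      let ?B = "set ps - A"
      \<comment> \<open>A variable of \<open>ps\<close> lies in exactly one of \<open>A\<close> and
        \<open>?B\<close>, so \<open>C ?B\<close> survives the deletion of
        \<open>C A\<close>.\<close>
      have "hd ps \<in> set ps" using assms(1) by simp
      then have "?B \<noteq> A" by blast
      then have "C ?B \<noteq> A'" using inj_on_eq_iff[OF inj, of ?B A] A by simp
      then have mem: "C ?B \<in> \<A> - {A'}" by (simp add: \<A>_def)
      assume "sat (Incl ps qs) (set_assignment \<Phi> ` (\<A> - {A'}))"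
      then have "\<forall>B\<in>\<A> - {A'}. \<exists>D\<in>\<A> - {A'}.
          map (set_assignment \<Phi> B) ps = map (set_assignment \<Phi> D) qs"
        by (simp only: sat.simps ball_simps bex_simps)
      from bspec[OF this mem] obtain D where D: "D \<in> \<A> - {A'}"
        "map (set_assignment \<Phi> (C ?B)) ps = map (set_assignment \<Phi> D) qs" by blast
      then obtain E where E: "E \<subseteq> set ps" "D = C E" by (auto simp: \<A>_def)
      then have "?B = set ps - E" using D(2) eq[of ?B E] by auto
      then have "A = E" using A(1) E(1) by blast
      then show False using D(1) E(2) A(2) by simp
    qed
  qed
  moreover have "card \<A> = 2 ^ length ps"
    using card_image[OF inj] assms(3) by (simp add: \<A>_def card_Pow distinct_card)
  ultimately show ?thesis by simp
qed

text \<open>The team of all values of \<open>ps\<close> and \<open>qs\<close> is critical: any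
  deleted combination is still demanded by two others, one sharing its \<open>ps\<close> value and
  one sharing its \<open>qs\<close> value.\<close>

lemma length_ge_Indep:
  assumes "ps \<noteq> []" and "qs \<noteq> []" and "distinct (ps @ qs)"
    and "\<phi> \<in> PL \<Sigma>" and "equivalent \<phi> (Indep ps qs)"
  shows "2 ^ (length ps + length qs) \<le> formula_length \<phi>"
proof -
  define \<Phi> where "\<Phi> = vars \<phi> \<union> vars (Indep ps qs)"
  have sub: "set ps \<subseteq> \<Phi>" "set qs \<subseteq> \<Phi>" by (auto simp: \<Phi>_def)
  have disj: "set ps \<inter> set qs = {}" using assms(3) by simp
  let ?\<A> = "Pow (set ps \<union> set qs)"
  have sat_iff: "sat (Indep ps qs) (set_assignment \<Phi> ` \<B>) \<longleftrightarrow>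
      (\<forall>A\<in>\<B>. \<forall>B\<in>\<B>. \<exists>C\<in>\<B>. C \<inter> set ps = A \<inter> set ps \<and> C \<inter> set qs = B \<inter> set qs)" for \<B>
    using sub by (simp add: map_set_assignment_eq_iff del: map_eq_conv)
  have "card ?\<A> \<le> formula_length \<phi>"
  proof (rule card_critical_family_le_length[OF assms(4,5) \<Phi>_def])
    have "\<exists>C\<in>?\<A>. C \<inter> set ps = A \<inter> set ps \<and> C \<inter> set qs = B \<inter> set qs" for A B
      using disj by (intro bexI[of _ "(A \<inter> set ps) \<union> (B \<inter> set qs)"]) auto
    then show "sat (Indep ps qs) (set_assignment \<Phi> ` ?\<A>)" unfolding sat_iff by blast
    show "\<not> sat (Indep ps qs) (set_assignment \<Phi> ` (?\<A> - {A}))" if A: "A \<in> ?\<A>" for A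
    proof
      assume sat: "sat (Indep ps qs) (set_assignment \<Phi> ` (?\<A> - {A}))"
      \<comment> \<open>\<open>?P\<close> agrees with \<open>A\<close> on \<open>ps\<close> and is
        complementary on \<open>qs\<close>; \<open>?Q\<close> does the reverse. Both differ from
        \<open>A\<close> because neither tuple is empty.\<close>
      let ?P = "(A \<inter> set ps) \<union> (set qs - A)" and ?Q = "(set ps - A) \<union> (A \<inter> set qs)"
      obtain p q where "p \<in> set ps" "q \<in> set qs" using assms(1,2) by (meson list.set_sel(1))
      then have "?P \<noteq> A" "?Q \<noteq> A" using disj by blast+
      then have mem: "?P \<in> ?\<A> - {A}" "?Q \<in> ?\<A> - {A}" by auto
      obtain C where C: "C \<in> ?\<A> - {A}"
        "C \<inter> set ps = ?P \<inter> set ps" "C \<inter> set qs = ?Q \<inter> set qs"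
        using bspec[OF bspec[OF sat[unfolded sat_iff] mem(1)] mem(2)] by (elim bexE conjE)
      have "C \<inter> set ps = A \<inter> set ps" "C \<inter> set qs = A \<inter> set qs"
        using C(2,3) disj by auto
      then have "C = A" using A C(1) by blast
      then show False using C(1) by simp
    qed
  qed simp
  moreover have "card ?\<A> = 2 ^ (length ps + length qs)"
    using assms(3) distinct_card[OF assms(3)] by (simp add: card_Pow)
  ultimately show ?thesis by simp
qed

text \<open>The team of all values of \<open>ps\<close> and \<open>q\<close> splits into pairs that
  differ only at \<open>q\<close>. Each partner is the sole witness for the other, so no assignment
  can be spared.\<close>

lemma length_ge_Anon:
  assumes "distinct (ps @ [q])" and "\<phi> \<in> PL \<Sigma>" and "equivalent \<phi> (Anon ps [q])"
  shows "2 ^ (length ps + 1) \<le> formula_length \<phi>"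
proof -
  define \<Phi> where "\<Phi> = vars \<phi> \<union> vars (Anon ps [q])"
  have sub: "set ps \<subseteq> \<Phi>" "set [q] \<subseteq> \<Phi>" by (auto simp: \<Phi>_def)
  have q: "q \<notin> set ps" using assms(1) by simp
  let ?\<A> = "Pow (insert q (set ps))"
  let ?flip = "\<lambda>A. if q \<in> A then A - {q} else insert q A"
  have sat_iff: "sat (Anon ps [q]) (set_assignment \<Phi> ` \<B>) \<longleftrightarrow>
      (\<forall>A\<in>\<B>. \<exists>B\<in>\<B>. B \<inter> set ps = A \<inter> set ps \<and> B \<inter> set [q] \<noteq> A \<inter> set [q])" for \<B>
    using sub by (simp only: sat.simps ball_simps bex_simps map_set_assignment_eq_iff)
  have flip: "B \<inter> set ps = A \<inter> set ps \<and> B \<inter> set [q] \<noteq> A \<inter> set [q] \<longleftrightarrow> B = ?flip A"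
    if "A \<in> ?\<A>" "B \<in> ?\<A>" for A B
  proof
    assume "B \<inter> set ps = A \<inter> set ps \<and> B \<inter> set [q] \<noteq> A \<inter> set [q]"
    moreover from this have "q \<in> B \<longleftrightarrow> q \<notin> A" by auto
    ultimately show "B = ?flip A" using that q by (auto split: if_splits)
  next
    assume "B = ?flip A"
    then show "B \<inter> set ps = A \<inter> set ps \<and> B \<inter> set [q] \<noteq> A \<inter> set [q]" using q by auto
  qed
  have flip_in: "?flip A \<in> ?\<A>" if "A \<in> ?\<A>" for A using that by auto
  have flip_neq: "?flip A \<noteq> A" and flip_flip: "?flip (?flip A) = A" for A by auto
  have "card ?\<A> \<le> formula_length \<phi>"
  proof (rule card_critical_family_le_length[OF assms(2,3) \<Phi>_def])
    show "sat (Anon ps [q]) (set_assignment \<Phi> ` ?\<A>)"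
      unfolding sat_iff
    proof
      fix A assume A: "A \<in> ?\<A>"
      show "\<exists>B\<in>?\<A>. B \<inter> set ps = A \<inter> set ps \<and> B \<inter> set [q] \<noteq> A \<inter> set [q]"
        using iffD2[OF flip[OF A flip_in[OF A]] refl] flip_in[OF A] by (rule bexI)
    qed
    show "\<not> sat (Anon ps [q]) (set_assignment \<Phi> ` (?\<A> - {A}))" if A: "A \<in> ?\<A>" for A
    proof
      assume sat: "sat (Anon ps [q]) (set_assignment \<Phi> ` (?\<A> - {A}))"
      \<comment> \<open>\<open>?flip A\<close> remains in the team, but the only witness for it is
        \<open>?flip (?flip A)\<close>, the deleted \<open>A\<close>.\<close>
      have "?flip A \<in> ?\<A> - {A}" using flip_in[OF A] flip_neq[of A] by blast
      from bspec[OF sat[unfolded sat_iff] this] obtain B where B: "B \<in> ?\<A> - {A}"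
        "B \<inter> set ps = ?flip A \<inter> set ps \<and> B \<inter> set [q] \<noteq> ?flip A \<inter> set [q]" ..
      then have "B = ?flip (?flip A)" using iffD1[OF flip[OF flip_in[OF A]] B(2)] by blast
      then show False using B(1) flip_flip[of A] by simp
    qed
  qed simp
  moreover have "card ?\<A> = 2 ^ (length ps + 1)"
    using assms(1) q by (simp add: card_Pow distinct_card)
  ultimately show ?thesis by simp
qed

theorem theorem3p4:
  fixes \<Sigma> :: "connective set" and n m :: nat and ps :: "'v list"
  assumes "\<Sigma> = {BDisj, Conj, Split, StrictSplit}"
    and "n \<ge> 1" and "m \<ge> 1"
    and "length ps = n" and "distinct ps"
  shows
    "(\<forall>k \<phi>. 2 \<le> m \<and> m \<le> 2 ^ n \<and> k < m \<and> \<phi> \<in> PL \<Sigma> \<and>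
        defines_property (set ps) \<phi> (\<lambda>T. [card T = k] (mod m)) \<longrightarrow>
        formula_length \<phi> \<ge> 2 ^ n - (2 ^ n - k) mod m) \<and>
     (\<forall>\<phi>. \<phi> \<in> PL \<Sigma> \<and> defines_property (set ps) \<phi> (\<lambda>T. even (card T)) \<longrightarrow>
        formula_length \<phi> \<ge> 2 ^ n) \<and>
     (\<forall>k \<phi>. k \<le> 2 ^ n \<and> \<phi> \<in> PL \<Sigma> \<and> defines_property (set ps) \<phi> (\<lambda>T. card T = k) \<longrightarrow>
        formula_length \<phi> \<ge> k) \<and>
     (\<forall>qs \<phi>. length qs = n \<and> distinct (ps @ qs) \<and> \<phi> \<in> PL \<Sigma> \<and> equivalent \<phi> (Incl ps qs) \<longrightarrow>
        formula_length \<phi> \<ge> 2 ^ n) \<and>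
     (\<forall>qs \<phi>. length qs = m \<and> distinct (ps @ qs) \<and> \<phi> \<in> PL \<Sigma> \<and> equivalent \<phi> (Indep ps qs) \<longrightarrow>
        formula_length \<phi> \<ge> 2 ^ (n + m)) \<and>
     (\<forall>q \<phi>. distinct (ps @ [q]) \<and> \<phi> \<in> PL \<Sigma> \<and> equivalent \<phi> (Anon ps [q]) \<longrightarrow>
        formula_length \<phi> \<ge> 2 ^ (n + 1))"
proof -
  have card_ps: "card (set ps) = n" using assms(4,5) by (simp add: distinct_card)
  have ps: "ps \<noteq> []" using assms(2,4) by auto
  have mod_card: "2 ^ n - (2 ^ n - k) mod m \<le> formula_length \<phi>"
    if "2 \<le> m" "m \<le> 2 ^ n" "k < m" "\<phi> \<in> PL \<Sigma>"
      "defines_property (set ps) \<phi> (\<lambda>T. [card T = k] (mod m))" for k \<phi>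
    \<comment> \<open>Chaining \<open>k < m\<close> and \<open>m \<le> 2 ^ n\<close> gives
      \<open>k \<le> 2 ^ n\<close>, so the subtraction \<open>2 ^ n - k\<close> is not
      truncated.\<close>
    using length_ge_card_mod[OF finite_set that(4,5,1)] that(2,3) by (simp add: card_ps)
  have even_card: "2 ^ n \<le> formula_length \<phi>"
    if "\<phi> \<in> PL \<Sigma>" "defines_property (set ps) \<phi> (\<lambda>T. even (card T))" for \<phi>
    using length_ge_even_card[OF finite_set _ that] ps by (simp add: card_ps)
  have exact_card: "k \<le> formula_length \<phi>"
    if "k \<le> 2 ^ n" "\<phi> \<in> PL \<Sigma>" "defines_property (set ps) \<phi> (\<lambda>T. card T = k)" for k \<phi>
    using le_length_if_defines_cardinality[OF finite_set that(2,3)] that(1) by (simp add: card_ps)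
  have incl: "2 ^ n \<le> formula_length \<phi>"
    if "length qs = n" "distinct (ps @ qs)" "\<phi> \<in> PL \<Sigma>" "equivalent \<phi> (Incl ps qs)" for qs \<phi>
    using length_ge_Incl[OF ps _ that(2-4)] that(1) assms(4) by simp
  have indep: "2 ^ (n + m) \<le> formula_length \<phi>"
    if "length qs = m" "distinct (ps @ qs)" "\<phi> \<in> PL \<Sigma>" "equivalent \<phi> (Indep ps qs)" for qs \<phi>
    using length_ge_Indep[OF ps _ that(2-4)] that(1) assms(3,4) by fastforce
  have anon: "2 ^ (n + 1) \<le> formula_length \<phi>"
    if "distinct (ps @ [q])" "\<phi> \<in> PL \<Sigma>" "equivalent \<phi> (Anon ps [q])" for q \<phi>
    using length_ge_Anon[OF that] assms(4) by simp
  show ?thesis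
    by (intro conjI allI impI; elim conjE)
      (rule mod_card even_card exact_card incl indep anon; assumption)+
qed

end
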